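(* Let $u\colon\mathbb{R}^3\to\mathbb{O}$ have octonion Fourier transform $U$. Let $\alpha,\beta,\gamma\in\mathbb{R}$ and denote $u^{\alpha}(\mathbf{x})=u(x_1-\alpha,x_2,x_3)$, $u^{\beta}(\mathbf{x})=u(x_1,x_2-\beta,x_3)$ and $u^{\gamma}(\mathbf{x})=u(x_1,x_2,x_3-\gamma)$. Let $U^{\ell}$ be the octonion Fourier transform of $u^{\ell}$, $\ell=\alpha,\beta,\gamma$. Then for all $(f_1,f_2,f_3)\in\mathbb{R}^3$ $$\begin{aligned} U^{\alpha}(f_1,f_2,f_3)&=\cos(2\pi f_1\alpha)\,U(f_1,f_2,f_3)-\sin(2\pi f_1\alpha)\,U(f_1,-f_2,-f_3)\cdot\mathbf{e}_1, \\ U^{\beta}(f_1,f_2,f_3)&=\cos(2\pi f_2\beta)\,U(f_1,f_2,f_3)-\sin(2\pi f_2\beta)\,U(f_1,f_2,-f_3)\cdot\mathbf{e}_2, \\ U^{\gamma}(f_1,f_2,f_3)&=\cos(2\pi f_3\gamma)\,U(f_1,f_2,f_3)-\sin(2\pi f_3\gamma)\,U(f_1,f_2,f_3)\cdot\mathbf{e}_4.\end{aligned}$$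
   Context: $\mathbb{O}$ denotes the real algebra of octonions with basis $1,\mathbf{e}_1,\dots,\mathbf{e}_7$: an octonion is a pair $(q_0,q_1)$ of quaternions (quaternion units $\mathbf{e}_1,\mathbf{e}_2,\mathbf{e}_3$ with $\mathbf{e}_1\mathbf{e}_2=\mathbf{e}_3$), with product $(q_0,q_1)\cdot(p_0,p_1)=(q_0p_0-p_1^*q_1,\;p_1q_0+q_1p_0^* )$, where $^*$ is quaternion conjugation, and $\mathbf{e}_4=(0,1)$, $\mathbf{e}_5=(0,\mathbf{e}_1)$, $\mathbf{e}_6=(0,\mathbf{e}_2)$, $\mathbf{e}_7=(0,\mathbf{e}_3)$. The product is neither commutative nor associative; products without brackets are evaluated from left to right, i.e. $abcd=((ab)c)d$. For an imaginary unit $\mathbf{e}_k$ and $\alpha\in\mathbb{R}$, $e^{\mathbf{e}_k\alpha}=\cos\alpha+\mathbf{e}_k\sin\alpha$. Integrals of octonion-valued functions are taken componentwise. The octonion Fourier transform (OFT) of a Lebesgue integrable $u\colon\mathbb{R}^3\to\mathbb{O}$ is $$U(\mathbf{f})=\int_{\mathbb{R}^3}u(\mathbf{x})\,e^{-\mathbf{e}_1 2\pi f_1x_1}\,e^{-\mathbf{e}_2 2\pi f_2x_2}\,e^{-\mathbf{e}_4 2\pi f_3x_3}\,d\mathbf{x},\qquad \mathbf{f}=(f_1,f_2,f_3)\in\mathbb{R}^3,$$ with multiplication from left to right. Standing assumption: $u$ is Lebesgue integrable, so that its OFT is well defined. *)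

theory Defs
  imports "HOL-Analysis.Analysis"
begin

section \<open>Quaternions\<close>

datatype quat = Quat (qre: real) (qim1: real) (qim2: real) (qim3: real)

instantiation quat :: ring_1
begin

definition zero_quat where "0 = Quat 0 0 0 0"

definition one_quat where "1 = Quat 1 0 0 0"

definition plus_quat where
  "p + q = Quat (qre p + qre q) (qim1 p + qim1 q) (qim2 p + qim2 q) (qim3 p + qim3 q)"

definition uminus_quat where
  "- p = Quat (- qre p) (- qim1 p) (- qim2 p) (- qim3 p)"

definition minus_quat where
  "p - q = Quat (qre p - qre q) (qim1 p - qim1 q) (qim2 p - qim2 q) (qim3 p - qim3 q)"

definition times_quat where
  "p * q = Quat
     (qre p * qre q - qim1 p * qim1 q - qim2 p * qim2 q - qim3 p * qim3 q)
     (qre p * qim1 q + qim1 p * qre q + qim2 p * qim3 q - qim3 p * qim2 q)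
     (qre p * qim2 q - qim1 p * qim3 q + qim2 p * qre q + qim3 p * qim1 q)
     (qre p * qim3 q + qim1 p * qim2 q - qim2 p * qim1 q + qim3 p * qre q)"

instance
  by standard
    (simp_all add: zero_quat_def one_quat_def plus_quat_def uminus_quat_def minus_quat_def
      times_quat_def algebra_simps)

end

lemmas quat_defs = zero_quat_def one_quat_def plus_quat_def uminus_quat_def minus_quat_def
  times_quat_def

definition qcnj :: "quat \<Rightarrow> quat" where
  "qcnj p = Quat (qre p) (- qim1 p) (- qim2 p) (- qim3 p)"

lemma quat_units:
  "Quat 0 1 0 0 * Quat 0 0 1 0 = Quat 0 0 0 1"
  "Quat 0 0 1 0 * Quat 0 0 0 1 = Quat 0 1 0 0"
  "Quat 0 0 0 1 * Quat 0 1 0 0 = Quat 0 0 1 0"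
  "Quat 0 1 0 0 * Quat 0 1 0 0 = - 1"
  "Quat 0 0 1 0 * Quat 0 0 1 0 = - 1"
  "Quat 0 0 0 1 * Quat 0 0 0 1 = - 1"
  by (simp_all add: quat_defs)


section \<open>Octonions\<close>

datatype octonion = Oct (ofst: quat) (osnd: quat)

lemma octonion_eq_iff:
  "a = b \<longleftrightarrow>
     qre (ofst a) = qre (ofst b) \<and> qim1 (ofst a) = qim1 (ofst b) \<and>
     qim2 (ofst a) = qim2 (ofst b) \<and> qim3 (ofst a) = qim3 (ofst b) \<and>
     qre (osnd a) = qre (osnd b) \<and> qim1 (osnd a) = qim1 (osnd b) \<and>
     qim2 (osnd a) = qim2 (osnd b) \<and> qim3 (osnd a) = qim3 (osnd b)"
  by (auto intro: octonion.expand quat.expand)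

text \<open>
  The Euclidean structure is the one for which \<open>1\<close>, \<open>oe1\<close>, \dots, \<open>oe7\<close> is an orthonormal basis.
  The product is not associative, so \<^typ>\<open>octonion\<close> is not an instance of a ring class.
\<close>

instantiation octonion :: "{one, times}"
begin

definition one_octonion where "1 = Oct 1 0"

definition times_octonion where
  "a * b = Oct (ofst a * ofst b - qcnj (osnd b) * osnd a)
               (osnd b * ofst a + osnd a * qcnj (ofst b))"

instance ..

end

definition oe1 :: octonion where "oe1 = Oct (Quat 0 1 0 0) 0"
definition oe2 :: octonion where "oe2 = Oct (Quat 0 0 1 0) 0"
definition oe3 :: octonion where "oe3 = Oct (Quat 0 0 0 1) 0"
definition oe4 :: octonion where "oe4 = Oct 0 1"
definition oe5 :: octonion where "oe5 = Oct 0 (Quat 0 1 0 0)"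
definition oe6 :: octonion where "oe6 = Oct 0 (Quat 0 0 1 0)"
definition oe7 :: octonion where "oe7 = Oct 0 (Quat 0 0 0 1)"

lemmas oe_defs = one_octonion_def oe1_def oe2_def oe3_def oe4_def oe5_def oe6_def oe7_def

instantiation octonion :: real_vector
begin

definition zero_octonion where "0 = Oct 0 0"

definition plus_octonion where "a + b = Oct (ofst a + ofst b) (osnd a + osnd b)"

definition uminus_octonion where "- a = Oct (- ofst a) (- osnd a)"

definition minus_octonion where "a - b = Oct (ofst a - ofst b) (osnd a - osnd b)"

definition scaleR_octonion where
  "r *\<^sub>R a = Oct
     (Quat (r * qre (ofst a)) (r * qim1 (ofst a)) (r * qim2 (ofst a)) (r * qim3 (ofst a)))
     (Quat (r * qre (osnd a)) (r * qim1 (osnd a)) (r * qim2 (osnd a)) (r * qim3 (osnd a)))"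

lemmas octonion_vector_defs = zero_octonion_def plus_octonion_def uminus_octonion_def
  minus_octonion_def scaleR_octonion_def

instance
proof
  fix a b c :: octonion and r s :: real
  show "a + b + c = a + (b + c)" "a + b = b + a" "0 + a = a" "- a + a = 0" "a - b = a + - b"
    by (simp_all add: octonion_vector_defs algebra_simps)
  show "r *\<^sub>R (a + b) = r *\<^sub>R a + r *\<^sub>R b" "(r + s) *\<^sub>R a = r *\<^sub>R a + s *\<^sub>R a"
    "r *\<^sub>R s *\<^sub>R a = (r * s) *\<^sub>R a" "1 *\<^sub>R a = a"
    by (simp_all add: octonion_vector_defs quat_defs algebra_simps)
qed

end

instantiation octonion :: real_inner
begin

definition inner_octonion where
  "a \<bullet> b =
     qre (ofst a) * qre (ofst b) + qim1 (ofst a) * qim1 (ofst b) +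
     qim2 (ofst a) * qim2 (ofst b) + qim3 (ofst a) * qim3 (ofst b) +
     qre (osnd a) * qre (osnd b) + qim1 (osnd a) * qim1 (osnd b) +
     qim2 (osnd a) * qim2 (osnd b) + qim3 (osnd a) * qim3 (osnd b)"

definition norm_octonion where "norm (a :: octonion) = sqrt (a \<bullet> a)"

definition sgn_octonion where "sgn (a :: octonion) = a /\<^sub>R norm a"

definition dist_octonion where "dist (a :: octonion) b = norm (a - b)"

definition uniformity_octonion :: "(octonion \<times> octonion) filter" where
  "uniformity_octonion = (INF e\<in>{0<..}. principal {(x, y). dist x y < e})"

definition open_octonion :: "octonion set \<Rightarrow> bool" where
  "open_octonion U \<longleftrightarrow> (\<forall>x\<in>U. \<forall>\<^sub>F (x', y) in uniformity. x' = x \<longrightarrow> y \<in> U)"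

instance
proof
  fix a b c :: octonion and r :: real
  show "a \<bullet> b = b \<bullet> a" "(a + b) \<bullet> c = a \<bullet> c + b \<bullet> c" "r *\<^sub>R a \<bullet> b = r * (a \<bullet> b)"
    by (simp_all add: inner_octonion_def octonion_vector_defs quat_defs algebra_simps)
  show "0 \<le> a \<bullet> a"
    by (simp add: inner_octonion_def)
  show "a \<bullet> a = 0 \<longleftrightarrow> a = 0"
    by (simp add: inner_octonion_def zero_octonion_def zero_quat_def octonion_eq_iff
        add_nonneg_eq_0_iff conj_assoc)
qed (fact dist_octonion_def sgn_octonion_def uniformity_octonion_def open_octonion_def
      norm_octonion_def)+

end

instantiation octonion :: euclidean_space
begin

definition Basis_octonion where
  "Basis = {1, oe1, oe2, oe3, oe4, oe5, oe6, oe7}"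

instance
proof
  fix a b :: octonion
  show "(Basis :: octonion set) \<noteq> {}" "finite (Basis :: octonion set)"
    by (simp_all add: Basis_octonion_def)
  show "a \<bullet> b = (if a = b then 1 else 0)" if "a \<in> Basis" "b \<in> Basis"
    using that unfolding Basis_octonion_def insert_iff empty_iff
    by (elim disjE FalseE; hypsubst; simp add: oe_defs inner_octonion_def zero_quat_def one_quat_def)
  show "(\<forall>b\<in>Basis. a \<bullet> b = 0) \<longleftrightarrow> a = 0"
    unfolding Basis_octonion_def octonion_eq_iff[of a 0] ball_simps
    by (simp add: oe_defs inner_octonion_def zero_octonion_def zero_quat_def one_quat_def)
qed

end

text \<open>The Bochner integral of an octonion-valued function is the componentwise integral.\<close>

lemma octonion_integrable_componentwise:
  fixes g :: "'a \<Rightarrow> octonion"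
  shows "integrable M g \<longleftrightarrow> (\<forall>b\<in>Basis. integrable M (\<lambda>x. g x \<bullet> b))"
proof
  assume "\<forall>b\<in>Basis. integrable M (\<lambda>x. g x \<bullet> b)"
  then have "integrable M (\<lambda>x. \<Sum>b\<in>Basis. (g x \<bullet> b) *\<^sub>R b)"
    by (intro Bochner_Integration.integrable_sum integrable_scaleR_left) simp
  then show "integrable M g"
    by (simp add: euclidean_representation)
qed simp

lemma octonion_integral_componentwise:
  fixes g :: "'a \<Rightarrow> octonion"
  assumes "integrable M g"
  shows "(LINT x|M. g x) = (\<Sum>b\<in>Basis. (LINT x|M. g x \<bullet> b) *\<^sub>R b)"
  using assms euclidean_representation[of "LINT x|M. g x"] by simp


section \<open>The octonion Fourier transform\<close>

definition oexp :: "octonion \<Rightarrow> real \<Rightarrow> octonion" where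
  "oexp e t = cos t *\<^sub>R 1 + sin t *\<^sub>R e"

text \<open>\<open>*\<close> associates to the left, so the integrand is multiplied from left to right.\<close>

definition OFT :: "(real^3 \<Rightarrow> octonion) \<Rightarrow> real^3 \<Rightarrow> octonion" where
  "OFT u f = (LINT x|lebesgue.
     u x * oexp oe1 (- (2 * pi * f$1 * x$1))
         * oexp oe2 (- (2 * pi * f$2 * x$2))
         * oexp oe4 (- (2 * pi * f$3 * x$3)))"

end

theory Submission
  imports Defs
begin

text \<open>
  Translating the variable of integration by \<open>a\<close> moves the shift from \<open>u\<close> into one of the three
  exponential factors. The difficulty is that the extra factor \<open>oexp e (- \<theta>)\<close> so obtained sits in the
  middle of a nonassociative product. Two consequences of the right alternative law
  \<open>(a e) e = a (e e)\<close> replace associativity and commutativity. First, \<open>a e e = - a\<close> for an imaginary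
  unit, so right multiplication by the elements \<open>oexp e t\<close> is an action of the additive reals and the
  extra factor can be split off as \<open>cos \<theta> - e sin \<theta>\<close> (\<open>octonion_mult_oexp_add\<close>). Second, the
  linearised law gives \<open>a e e' = - a e' e\<close> for orthogonal imaginary units, so a right factor \<open>e\<close> can be
  carried to the end of the product at the price of reversing the sign of the angle in each later
  exponential (\<open>octonion_mult_oexp_anticommute\<close>). This is the origin of the sign changes in the
  frequencies: in the sine term of a shift in one coordinate, exactly the frequencies that come after
  it are reversed.

  These identities hold for each value of the integrand (\<open>OFT_integrand_shift\<close>). They pass to the
  transform (\<open>OFT_shift\<close>) because Lebesgue measure is translation invariant and right multiplication
  by a fixed octonion is bounded and linear, so that it commutes with the integral.
\<close>

section \<open>Right multiplication in the octonions\<close>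

lemma octonion_mult_add_left: "(a + b) * c = a * c + b * (c :: octonion)"
  by (simp add: times_octonion_def plus_octonion_def algebra_simps)

lemma octonion_mult_scaleR_left: "(r *\<^sub>R a) * b = r *\<^sub>R (a * (b :: octonion))"
  by (simp add: times_octonion_def scaleR_octonion_def qcnj_def quat_defs algebra_simps)

lemma linear_octonion_mult_left: "linear (\<lambda>a. a * (b :: octonion))"
  by (intro linearI octonion_mult_add_left octonion_mult_scaleR_left)

lemmas bounded_linear_octonion_mult_left =
  linear_conv_bounded_linear[THEN iffD1, OF linear_octonion_mult_left]

lemma octonion_mult_diff_left: "(a - b) * c = a * c - b * (c :: octonion)"
  by (rule linear_diff[OF linear_octonion_mult_left])

lemma octonion_mult_oexp: "a * oexp e t = cos t *\<^sub>R a + sin t *\<^sub>R (a * e)"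
  by (simp add: oexp_def octonion_eq_iff times_octonion_def octonion_vector_defs
      one_octonion_def qcnj_def quat_defs algebra_simps)

text \<open>
  The instances of the right alternative law, and of its linearisation
  \<open>a b c + a c b = a (b c + c b)\<close>, for the three imaginary units in the kernel of the transform.
\<close>

lemma octonion_mult_units:
  "a * oe1 * oe1 = - a" "a * oe2 * oe2 = - a" "a * oe4 * oe4 = - a"
  "a * oe1 * oe2 = - (a * oe2 * oe1)"
  "a * oe1 * oe4 = - (a * oe4 * oe1)"
  "a * oe2 * oe4 = - (a * oe4 * oe2)"
  by (simp_all add: octonion_eq_iff times_octonion_def uminus_octonion_def
      oe_defs qcnj_def quat_defs)

text \<open>
  On the span of \<open>a\<close> and \<open>a * e\<close>, right multiplication by \<open>e\<close> squares to \<open>-1\<close>; hence right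
  multiplication by \<open>oexp e t\<close> is there the rotation by the angle \<open>t\<close>, and rotations compose by the
  addition formulas for sine and cosine.
\<close>

lemma octonion_mult_oexp_add:
  assumes "\<And>a. a * e * e = - a"
  shows "a * oexp e (s + t) = cos t *\<^sub>R (a * oexp e s) + sin t *\<^sub>R (a * oexp e s * e)"
  by (simp add: octonion_mult_oexp octonion_mult_add_left octonion_mult_scaleR_left assms
      cos_add sin_add algebra_simps)

text \<open>
  Passing \<open>e\<close> over \<open>oexp e' t\<close> leaves the cosine term alone and changes the sign of the sine term,
  which amounts to reversing the angle.
\<close>

lemma octonion_mult_oexp_anticommute:
  assumes "\<And>a. a * e * e' = - (a * e' * e)"
  shows "a * e * oexp e' t = a * oexp e' (- t) * e"
  by (simp add: octonion_mult_oexp octonion_mult_add_left octonion_mult_diff_left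
      octonion_mult_scaleR_left assms algebra_simps)

section \<open>Integrability and translation\<close>

text \<open>
  The product is a combination of \<open>w\<close> and \<open>w * e\<close> whose coefficients are measurable and bounded
  by 1.
\<close>

lemma integrable_mult_oexp:
  assumes "integrable M w" and "g \<in> borel_measurable M"
  shows "integrable M (\<lambda>x. w x * oexp e (g x))"
proof -
  have scaled: "integrable M (\<lambda>x. h (g x) *\<^sub>R v x)"
    if "integrable M v" and "continuous_on UNIV h" and "\<And>t. \<bar>h t\<bar> \<le> 1"
    for v :: "'a \<Rightarrow> octonion" and h :: "real \<Rightarrow> real"
  proof (rule Bochner_Integration.integrable_bound[OF that(1)])
    have "(\<lambda>x. h (g x)) \<in> borel_measurable M"
      by (rule borel_measurable_continuous_on[OF that(2) assms(2)])
    then show "(\<lambda>x. h (g x) *\<^sub>R v x) \<in> borel_measurable M"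
      using that(1) by (intro borel_measurable_scaleR) auto
    show "AE x in M. norm (h (g x) *\<^sub>R v x) \<le> norm (v x)"
      using that(3) by (simp add: mult_left_le_one_le)
  qed
  have "integrable M (\<lambda>x. w x * e)"
    by (rule integrable_bounded_linear[OF bounded_linear_octonion_mult_left assms(1)])
  with assms(1) show ?thesis
    unfolding octonion_mult_oexp
    by (intro Bochner_Integration.integrable_add scaled continuous_intros) simp_all
qed

text \<open>
  Translations are the affine maps of unit dilation in every coordinate, so they leave Lebesgue
  measure on the completed \<open>\<sigma>\<close>-algebra unchanged.
\<close>

lemma lebesgue_integral_translation:
  fixes h :: "'a :: euclidean_space \<Rightarrow> 'b :: {banach, second_countable_topology}"
  assumes "h \<in> borel_measurable lebesgue"
  shows "(LINT x|lebesgue. h (x - a)) = (LINT x|lebesgue. h x)"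
proof -
  let ?T = "\<lambda>x. - a + (\<Sum>j\<in>Basis. (1 * (x \<bullet> j)) *\<^sub>R j)"
  have T: "?T = (\<lambda>x. x - a)"
    by (simp add: euclidean_representation)
  have meas: "(\<lambda>x. x - a) \<in> lebesgue \<rightarrow>\<^sub>M lebesgue"
    using lebesgue_affine_measurable[of "\<lambda>_. 1" "- a"] unfolding T by simp
  have "lebesgue = distr lebesgue lebesgue (\<lambda>x. x - a)"
    using lebesgue_affine_euclidean[of "\<lambda>_. 1" "- a"] unfolding T by (simp add: density_1)
  then have "(LINT x|lebesgue. h x) = (LINT x|distr lebesgue lebesgue (\<lambda>x. x - a). h x)"
    by simp
  also have "\<dots> = (LINT x|lebesgue. h (x - a))"
    by (rule integral_distr[OF meas assms])
  finally show ?thesis by simp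
qed

section \<open>The shift rule\<close>

text \<open>
  The value \<open>w\<close> of the signal is separated from the point \<open>x\<close>, because a translation moves the
  argument of the exponentials but not that of the signal.
\<close>

definition OFT_integrand :: "real^3 \<Rightarrow> real^3 \<Rightarrow> octonion \<Rightarrow> octonion" where
  "OFT_integrand f x w =
     w * oexp oe1 (- (2 * pi * f$1 * x$1))
       * oexp oe2 (- (2 * pi * f$2 * x$2))
       * oexp oe4 (- (2 * pi * f$3 * x$3))"

lemma OFT_eq_integrand: "OFT u f = (LINT x|lebesgue. OFT_integrand f x (u x))"
  by (simp add: OFT_def OFT_integrand_def)

lemma integrable_OFT_integrand:
  assumes "integrable lebesgue u"
  shows "integrable lebesgue (\<lambda>x. OFT_integrand f x (u x))"
proof -
  have "(\<lambda>x :: real^3. - (2 * pi * f$k * x$k)) \<in> borel_measurable borel" for k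
    by (intro borel_measurable_continuous_onI continuous_intros)
  then have "(\<lambda>x :: real^3. - (2 * pi * f$k * x$k)) \<in> borel_measurable lebesgue" for k
    by (intro measurable_completion) simp
  then show ?thesis
    unfolding OFT_integrand_def using assms by (intro integrable_mult_oexp)
qed

text \<open>
  The three shift rules have the same shape and differ only in the pointwise identity for the
  integrand, which is therefore a hypothesis. In each rule \<open>f'\<close> is obtained from
  \<open>f\<close> by reversing the signs of the later frequencies.
\<close>

lemma OFT_shift:
  assumes "integrable lebesgue u"
    and shift: "\<And>x w. OFT_integrand f (x + a) w =
      cos \<theta> *\<^sub>R OFT_integrand f x w - sin \<theta> *\<^sub>R (OFT_integrand f' x w * e)"
  shows "OFT (\<lambda>x. u (x - a)) f = cos \<theta> *\<^sub>R OFT u f - sin \<theta> *\<^sub>R OFT u f' * e"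
proof -
  note int = integrable_OFT_integrand[OF assms(1)]
  note bl = bounded_linear_octonion_mult_left[of e]
  \<comment> \<open>The integrand after the substitution \<open>x = y + a\<close>.\<close>
  let ?h = "\<lambda>y. OFT_integrand f (y + a) (u y)"
  have int_e: "integrable lebesgue (\<lambda>x. OFT_integrand f' x (u x) * e)"
    by (rule integrable_bounded_linear[OF bl int])
  have "integrable lebesgue ?h"
    unfolding shift
    by (intro Bochner_Integration.integrable_diff integrable_scaleR_right int int_e)
  then have "(LINT x|lebesgue. ?h (x - a)) = (LINT x|lebesgue. ?h x)"
    by (intro lebesgue_integral_translation) auto
  then have "OFT (\<lambda>x. u (x - a)) f = (LINT x|lebesgue. ?h x)"
    by (simp add: OFT_eq_integrand)
  also have "\<dots> = cos \<theta> *\<^sub>R OFT u f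
      - sin \<theta> *\<^sub>R (LINT x|lebesgue. OFT_integrand f' x (u x) * e)"
    unfolding shift OFT_eq_integrand
    by (subst Bochner_Integration.integral_diff) (auto intro: int int_e integrable_scaleR_right)
  also have "(LINT x|lebesgue. OFT_integrand f' x (u x) * e) = OFT u f' * e"
    unfolding OFT_eq_integrand by (rule integral_bounded_linear[OF bl int])
  finally show ?thesis
    by (simp add: octonion_mult_scaleR_left)
qed

text \<open>
  The addition rule splits the shifted exponential and leaves a factor \<open>e\<close> behind it; the
  anticommutation rule then carries \<open>e\<close> over the remaining exponentials. There are two of these for
  \<open>oe1\<close>, one for \<open>oe2\<close> and none for \<open>oe4\<close>, hence the different numbers of reversed frequencies.
\<close>

lemma OFT_integrand_shift:
  fixes f1 f2 f3 s :: real
  shows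
   "OFT_integrand (vector [f1, f2, f3]) (x + vector [s, 0, 0]) w =
      cos (2 * pi * f1 * s) *\<^sub>R OFT_integrand (vector [f1, f2, f3]) x w
      - sin (2 * pi * f1 * s) *\<^sub>R (OFT_integrand (vector [f1, - f2, - f3]) x w * oe1)"
   "OFT_integrand (vector [f1, f2, f3]) (x + vector [0, s, 0]) w =
      cos (2 * pi * f2 * s) *\<^sub>R OFT_integrand (vector [f1, f2, f3]) x w
      - sin (2 * pi * f2 * s) *\<^sub>R (OFT_integrand (vector [f1, f2, - f3]) x w * oe2)"
   "OFT_integrand (vector [f1, f2, f3]) (x + vector [0, 0, s]) w =
      cos (2 * pi * f3 * s) *\<^sub>R OFT_integrand (vector [f1, f2, f3]) x w
      - sin (2 * pi * f3 * s) *\<^sub>R (OFT_integrand (vector [f1, f2, f3]) x w * oe4)"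
proof -
  have split: "a * oexp e (- (2 * pi * g * (r + s))) =
      cos (2 * pi * g * s) *\<^sub>R (a * oexp e (- (2 * pi * g * r)))
      - sin (2 * pi * g * s) *\<^sub>R (a * oexp e (- (2 * pi * g * r)) * e)"
    if "\<And>a. a * e * e = - a" for a e g r
    using octonion_mult_oexp_add[OF that, where a = a and s = "- (2 * pi * g * r)"
        and t = "- (2 * pi * g * s)"]
    by (simp add: algebra_simps)
  note units = octonion_mult_units
  note rules = OFT_integrand_def vector_3 vector_add_component octonion_mult_diff_left
    octonion_mult_scaleR_left
  show "OFT_integrand (vector [f1, f2, f3]) (x + vector [s, 0, 0]) w =
      cos (2 * pi * f1 * s) *\<^sub>R OFT_integrand (vector [f1, f2, f3]) x w
      - sin (2 * pi * f1 * s) *\<^sub>R (OFT_integrand (vector [f1, - f2, - f3]) x w * oe1)"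
    by (simp add: rules split[OF units(1)] octonion_mult_oexp_anticommute[OF units(4)]
      octonion_mult_oexp_anticommute[OF units(5)])
  show "OFT_integrand (vector [f1, f2, f3]) (x + vector [0, s, 0]) w =
      cos (2 * pi * f2 * s) *\<^sub>R OFT_integrand (vector [f1, f2, f3]) x w
      - sin (2 * pi * f2 * s) *\<^sub>R (OFT_integrand (vector [f1, f2, - f3]) x w * oe2)"
    by (simp add: rules split[OF units(2)] octonion_mult_oexp_anticommute[OF units(6)])
  show "OFT_integrand (vector [f1, f2, f3]) (x + vector [0, 0, s]) w =
      cos (2 * pi * f3 * s) *\<^sub>R OFT_integrand (vector [f1, f2, f3]) x w
      - sin (2 * pi * f3 * s) *\<^sub>R (OFT_integrand (vector [f1, f2, f3]) x w * oe4)"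
    by (simp add: rules split[OF units(3)])
qed

theorem theorem13:
  fixes u :: "real^3 \<Rightarrow> octonion"
    and \<alpha> \<beta> \<gamma> f1 f2 f3 :: real
  assumes "integrable lebesgue u"
  shows "OFT (\<lambda>x. u (vector [x$1 - \<alpha>, x$2, x$3])) (vector [f1, f2, f3]) =
           cos (2 * pi * f1 * \<alpha>) *\<^sub>R OFT u (vector [f1, f2, f3])
           - sin (2 * pi * f1 * \<alpha>) *\<^sub>R OFT u (vector [f1, - f2, - f3]) * oe1 \<and>
         OFT (\<lambda>x. u (vector [x$1, x$2 - \<beta>, x$3])) (vector [f1, f2, f3]) =
           cos (2 * pi * f2 * \<beta>) *\<^sub>R OFT u (vector [f1, f2, f3])
           - sin (2 * pi * f2 * \<beta>) *\<^sub>R OFT u (vector [f1, f2, - f3]) * oe2 \<and>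
         OFT (\<lambda>x. u (vector [x$1, x$2, x$3 - \<gamma>])) (vector [f1, f2, f3]) =
           cos (2 * pi * f3 * \<gamma>) *\<^sub>R OFT u (vector [f1, f2, f3])
           - sin (2 * pi * f3 * \<gamma>) *\<^sub>R OFT u (vector [f1, f2, f3]) * oe4"
proof -
  have shifts:
    "vector [x$1 - \<alpha>, x$2, x$3] = x - vector [\<alpha>, 0, 0]"
    "vector [x$1, x$2 - \<beta>, x$3] = x - vector [0, \<beta>, 0]"
    "vector [x$1, x$2, x$3 - \<gamma>] = x - vector [0, 0, \<gamma>]" for x :: "real^3"
    by (simp_all add: vec_eq_iff forall_3)
  show ?thesis
    unfolding shifts
    by (intro conjI OFT_shift[OF assms] OFT_integrand_shift)
qed

end
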